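(* Let $\mathbf G=(V,E)$ be a finite simple undirected graph. Let $z$ and $\mathbf z_E=(z_{uv})_{uv\in E}$ be independent commuting indeterminates, and define $$\Psi_{\mathbf G}(z,\mathbf z_E)=\prod_{v\in V}\bigl(1+z\,Z_{E(v)}\bigr)\prod_{uv\in E}(1+z_{uv}),$$ where $Z_{E(v)}$ is the product of the $z_e$ over all edges $e\in E$ incident to $v$. Then the graph polynomial of the number of independent sets of $\mathbf G$ is $$\pi_\alpha(z)=\Bigl[\textstyle\prod_{uv\in E}z_{uv}\Bigr]\,\Psi_{\mathbf G}(z,\mathbf z_E),$$ and the graph polynomial of the number of vertex covers of $\mathbf G$ is $$\pi_\beta(z)=\Bigl[\textstyle\prod_{uv\in E}z_{uv}^2\Bigr]\,\Psi_{\mathbf G}(z,\mathbf z_E).$$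
   Context: An independent set is a subset of $V$ no two of whose vertices are adjacent; a vertex cover is a subset of $V$ that includes at least one endpoint of every edge in $E$; the order of either is its cardinality. $A_k$ and $B_k$ are, respectively, the number of independent sets and the number of vertex covers of order $k\ge0$, and $\pi_\alpha(z)=\sum_{k\ge0}A_kz^k$, $\pi_\beta(z)=\sum_{k\ge0}B_kz^k$. The bracket $[M]F$, for a monomial $M$ in the edge indeterminates, denotes the coefficient of $M$ when $F$ is regarded as a polynomial in the edge indeterminates with coefficients that are polynomials in $z$. An empty product equals $1$. *)

theory Defs
  imports
    "HOL-Library.Ramsey"
    "HOL-Library.Poly_Mapping"
    "HOL-Computational_Algebra.Polynomial"
begin

definition finite_simple_graph :: "'a set \<Rightarrow> 'a set set \<Rightarrow> bool" where
  "finite_simple_graph V E \<longleftrightarrow> finite V \<and> E \<subseteq> [V]\<^bsup>2\<^esup>"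

text \<open>Independence is \<^const>\<open>indep\<close>. For a simple graph its restriction to distinct
  vertices is immaterial, as no edge is a singleton.\<close>

definition num_indep_sets :: "'a set \<Rightarrow> 'a set set \<Rightarrow> nat \<Rightarrow> nat" where
  "num_indep_sets V E k = card {S. S \<subseteq> V \<and> indep S E \<and> card S = k}"

definition vertex_cover :: "'a set \<Rightarrow> 'a set set \<Rightarrow> bool" where
  "vertex_cover S E \<longleftrightarrow> (\<forall>e\<in>E. e \<inter> S \<noteq> {})"

definition num_vertex_covers :: "'a set \<Rightarrow> 'a set set \<Rightarrow> nat \<Rightarrow> nat" where
  "num_vertex_covers V E k = card {S. S \<subseteq> V \<and> vertex_cover S E \<and> card S = k}"

text \<open>The generating polynomials are cut off at \<^term>\<open>card V\<close>, beyond which all counts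
  vanish; the coefficient lemmas below hold for every \<^term>\<open>k\<close>.\<close>

definition indep_poly :: "'a set \<Rightarrow> 'a set set \<Rightarrow> int poly" where
  "indep_poly V E = (\<Sum>k\<le>card V. monom (int (num_indep_sets V E k)) k)"

definition cover_poly :: "'a set \<Rightarrow> 'a set set \<Rightarrow> int poly" where
  "cover_poly V E = (\<Sum>k\<le>card V. monom (int (num_vertex_covers V E k)) k)"

lemma coeff_indep_poly:
  assumes "finite V"
  shows "coeff (indep_poly V E) k = int (num_indep_sets V E k)"
proof -
  have "num_indep_sets V E k = 0" if "card V < k"
  proof -
    have "{S. S \<subseteq> V \<and> indep S E \<and> card S = k} = {}"
      using card_mono[OF assms] that by (auto simp: not_le[symmetric])
    then show ?thesis by (simp only: num_indep_sets_def card.empty)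
  qed
  then have *: "k \<le> card V \<or> num_indep_sets V E k = 0" by (meson not_le)
  show ?thesis
    using * by (auto simp: indep_poly_def coeff_sum)
qed

lemma coeff_cover_poly:
  assumes "finite V"
  shows "coeff (cover_poly V E) k = int (num_vertex_covers V E k)"
proof -
  have "num_vertex_covers V E k = 0" if "card V < k"
  proof -
    have "{S. S \<subseteq> V \<and> vertex_cover S E \<and> card S = k} = {}"
      using card_mono[OF assms] that by (auto simp: not_le[symmetric])
    then show ?thesis by (simp only: num_vertex_covers_def card.empty)
  qed
  then have *: "k \<le> card V \<or> num_vertex_covers V E k = 0" by (meson not_le)
  show ?thesis
    using * by (auto simp: cover_poly_def coeff_sum)
qed

text \<open>Polynomials in indeterminates indexed by \<^typ>\<open>'e\<close> with coefficients in \<^typ>\<open>int poly\<close>,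
  as the monoid algebra over the finitely supported exponent vectors. The indeterminate of
  \<^typ>\<open>int poly\<close> plays the role of \<open>z\<close>; the coefficient of a monomial is obtained by
  \<^const>\<open>Poly_Mapping.lookup\<close> at its exponent vector.\<close>

type_synonym 'e edge_poly = "('e \<Rightarrow>\<^sub>0 nat) \<Rightarrow>\<^sub>0 int poly"

definition z_var :: "'e edge_poly" where
  "z_var = Poly_Mapping.single 0 [:0, 1:]"

definition edge_var :: "'e \<Rightarrow> 'e edge_poly" where
  "edge_var e = Poly_Mapping.single (Poly_Mapping.single e 1) 1"

definition edge_monom_exp :: "'e set \<Rightarrow> nat \<Rightarrow> 'e \<Rightarrow>\<^sub>0 nat" where
  "edge_monom_exp E n = (\<Sum>e\<in>E. Poly_Mapping.single e n)"

lemma edge_var_power: "edge_var e ^ n = Poly_Mapping.single (Poly_Mapping.single e n) 1"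
  by (induction n) (simp_all add: edge_var_def mult_single single_add[symmetric])

lemma prod_edge_var_power:
  "(\<Prod>e\<in>E. edge_var e ^ n) = Poly_Mapping.single (edge_monom_exp E n) 1"
  unfolding edge_monom_exp_def
  by (induction E rule: infinite_finite_induct) (simp_all add: edge_var_power mult_single)

definition graph_Psi :: "'a set \<Rightarrow> 'a set set \<Rightarrow> 'a set edge_poly" where
  "graph_Psi V E =
     (\<Prod>v\<in>V. 1 + z_var * (\<Prod>e\<in>{e\<in>E. v \<in> e}. edge_var e)) * (\<Prod>e\<in>E. 1 + edge_var e)"

end

theory Submission
  imports Defs
begin

text \<open>
  Expand both products of \<^const>\<open>graph_Psi\<close>: a term is given by a set \<open>S\<close> of vertices and a
  set \<open>F\<close> of edges, carries the factor \<open>z\<close> to the power \<open>card S\<close>, and contains the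
  indeterminate of an edge \<open>e\<close> to the power \<open>card (S \<inter> e)\<close>, plus one if \<open>e \<in> F\<close>. If all
  these exponents are required to equal \<open>m + 1\<close>, then \<open>S\<close> leaves no choice for \<open>F\<close>: it has to
  consist of the edges with exactly \<open>m\<close> endpoints in \<open>S\<close>, and all others must have \<open>m + 1\<close>
  of them. So the coefficient enumerates, by cardinality, the vertex sets that
  contain \<open>m\<close> or \<open>m + 1\<close> endpoints of every edge (lemma \<open>lookup_graph_Psi\<close>). As an edge has
  two endpoints, these are the independent sets for \<open>m = 0\<close> and the vertex covers for \<open>m = 1\<close>.
\<close>

lemma finite_simple_graph_finite_edges:
  assumes "finite_simple_graph V E"
  shows "finite E"
  using assms unfolding finite_simple_graph_def nsets_def
  by (auto intro: finite_subset[of E "Pow V"])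

lemma lookup_edge_monom_exp:
  assumes "finite E"
  shows "Poly_Mapping.lookup (edge_monom_exp E n) e = (if e \<in> E then n else 0)"
  using assms by (simp add: edge_monom_exp_def lookup_sum lookup_single when_def)

lemma prod_single:
  fixes c :: "'i \<Rightarrow> 'b::comm_semiring_1" and f :: "'i \<Rightarrow> 'm::comm_monoid_add"
  shows "(\<Prod>x\<in>A. Poly_Mapping.single (f x) (c x)) = Poly_Mapping.single (\<Sum>x\<in>A. f x) (\<Prod>x\<in>A. c x)"
  by (induction A rule: infinite_finite_induct) (simp_all add: mult_single)

lemma prod_one_plus_single:
  fixes c :: "'b::comm_semiring_1" and f :: "'i \<Rightarrow> 'm::comm_monoid_add"
  assumes "finite A"
  shows "(\<Prod>x\<in>A. 1 + Poly_Mapping.single (f x) c)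
    = (\<Sum>S\<in>Pow A. Poly_Mapping.single (\<Sum>x\<in>S. f x) (c ^ card S))"
proof -
  have "(\<Prod>x\<in>A. Poly_Mapping.single (f x) c + 1)
      = (\<Sum>S\<in>Pow A. (\<Prod>x\<in>S. Poly_Mapping.single (f x) c) * (\<Prod>x\<in>A - S. 1))"
    by (rule prod_add[OF assms])
  then show ?thesis
    by (simp add: prod_single add.commute)
qed

lemma graph_Psi_expansion:
  assumes "finite V" and "finite E"
  shows "graph_Psi V E = (\<Sum>S\<in>Pow V. \<Sum>F\<in>Pow E. Poly_Mapping.single
    ((\<Sum>v\<in>S. edge_monom_exp {e\<in>E. v \<in> e} 1) + edge_monom_exp F 1) (monom 1 (card S)))"
proof -
  have z: "z_var * (\<Prod>e\<in>{e\<in>E. v \<in> e}. edge_var e)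
      = Poly_Mapping.single (edge_monom_exp {e\<in>E. v \<in> e} 1) (monom 1 1)" for v
    using prod_edge_var_power[where E = "{e\<in>E. v \<in> e}" and n = 1]
    by (simp add: z_var_def mult_single monom_altdef)
  have "(\<Prod>e\<in>E. 1 + edge_var e) = (\<Sum>F\<in>Pow E. Poly_Mapping.single (edge_monom_exp F 1) (1 :: int poly))"
    using prod_one_plus_single[OF assms(2), of "\<lambda>e. Poly_Mapping.single e (1::nat)" "1 :: int poly"]
    by (simp add: edge_var_def edge_monom_exp_def)
  then show ?thesis
    unfolding graph_Psi_def z prod_one_plus_single[OF assms(1)]
    by (simp add: sum_product mult_single monom_power)
qed

text \<open>Double counting of the incidences between \<open>S\<close> and \<open>e\<close> turns the exponent contributed by
  the vertices of \<open>S\<close> into \<open>card (S \<inter> e)\<close>.\<close>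

lemma lookup_vertex_edge_exponent:
  assumes "finite S" and "finite E" and "F \<subseteq> E"
  shows "Poly_Mapping.lookup ((\<Sum>v\<in>S. edge_monom_exp {e\<in>E. v \<in> e} 1) + edge_monom_exp F 1) e
    = (if e \<in> E then card (S \<inter> e) + of_bool (e \<in> F) else 0)"
proof -
  have "finite F"
    using assms finite_subset by blast
  have "(\<Sum>v\<in>S. Poly_Mapping.lookup (edge_monom_exp {e\<in>E. v \<in> e} 1) e)
      = (\<Sum>v\<in>S. if e \<in> E \<and> v \<in> e then 1 else 0)"
    using assms(2) by (intro sum.cong refl) (auto simp: lookup_edge_monom_exp)
  also have "\<dots> = (if e \<in> E then card (S \<inter> e) else 0)"
    using assms(1) by (simp add: sum.inter_restrict[symmetric])
  finally show ?thesis
    using assms(3) \<open>finite F\<close> by (auto simp: lookup_add lookup_sum lookup_edge_monom_exp)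
qed

text \<open>\<open>F\<close> can raise the exponent of an edge by one at most, and must do so exactly where
  the vertices of \<open>S\<close> contribute \<open>m\<close>. Hence the sum over \<open>F\<close> in the expansion has at most
  one term that counts.\<close>

lemma vertex_edge_exponent_eq_iff:
  assumes "finite S" and "finite E" and "F \<subseteq> E"
  shows "(\<Sum>v\<in>S. edge_monom_exp {e\<in>E. v \<in> e} 1) + edge_monom_exp F 1 = edge_monom_exp E (Suc m)
    \<longleftrightarrow> (\<forall>e\<in>E. card (S \<inter> e) \<in> {m, Suc m}) \<and> F = {e\<in>E. card (S \<inter> e) = m}"
proof -
  have "(\<Sum>v\<in>S. edge_monom_exp {e\<in>E. v \<in> e} 1) + edge_monom_exp F 1 = edge_monom_exp E (Suc m)
    \<longleftrightarrow> (\<forall>e\<in>E. card (S \<inter> e) + of_bool (e \<in> F) = Suc m)"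
    unfolding poly_mapping_eq_iff fun_eq_iff lookup_vertex_edge_exponent[OF assms]
      lookup_edge_monom_exp[OF assms(2)] by auto
  also have "\<dots> \<longleftrightarrow> (\<forall>e\<in>E. card (S \<inter> e) \<in> {m, Suc m} \<and> (e \<in> F \<longleftrightarrow> card (S \<inter> e) = m))"
    by (intro ball_cong refl) auto
  also have "\<dots> \<longleftrightarrow> (\<forall>e\<in>E. card (S \<inter> e) \<in> {m, Suc m}) \<and> F = {e\<in>E. card (S \<inter> e) = m}"
    using assms(3) by blast
  finally show ?thesis .
qed

lemma lookup_graph_Psi:
  assumes "finite V" and "finite E"
  shows "Poly_Mapping.lookup (graph_Psi V E) (edge_monom_exp E (Suc m))
    = (\<Sum>S | S \<subseteq> V \<and> (\<forall>e\<in>E. card (S \<inter> e) \<in> {m, Suc m}). monom 1 (card S))"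
proof -
  let ?P = "\<lambda>S. \<forall>e\<in>E. card (S \<inter> e) \<in> {m, Suc m}"
  have inner: "(\<Sum>F\<in>Pow E. Poly_Mapping.lookup (Poly_Mapping.single
      ((\<Sum>v\<in>S. edge_monom_exp {e\<in>E. v \<in> e} 1) + edge_monom_exp F 1) (monom 1 (card S)))
      (edge_monom_exp E (Suc m))) = (if ?P S then monom (1::int) (card S) else 0)"
    if "S \<in> Pow V" for S
  proof -
    have "finite S"
      using that assms(1) finite_subset by auto
    then have "(\<Sum>F\<in>Pow E. Poly_Mapping.lookup (Poly_Mapping.single
        ((\<Sum>v\<in>S. edge_monom_exp {e\<in>E. v \<in> e} 1) + edge_monom_exp F 1) (monom (1::int) (card S)))
        (edge_monom_exp E (Suc m)))
      = (\<Sum>F\<in>Pow E. if F = {e\<in>E. card (S \<inter> e) = m} then if ?P S then monom 1 (card S) else 0 else 0)"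
      using assms(2)
      by (intro sum.cong refl) (simp only: lookup_single when_def Pow_iff vertex_edge_exponent_eq_iff, simp)
    also have "\<dots> = (if ?P S then monom 1 (card S) else 0)"
      using assms(2) by (subst sum.delta) auto
    finally show ?thesis .
  qed
  have "Poly_Mapping.lookup (graph_Psi V E) (edge_monom_exp E (Suc m))
      = (\<Sum>S\<in>Pow V. if ?P S then monom 1 (card S) else 0)"
    unfolding graph_Psi_expansion[OF assms] lookup_sum by (rule sum.cong[OF refl inner])
  also have "\<dots> = (\<Sum>S | S \<in> Pow V \<and> ?P S. monom 1 (card S))"
    using assms(1) by (intro sum.inter_filter[symmetric]) simp
  finally show ?thesis
    by simp
qed

lemma sum_monom_card_subsets:
  assumes "finite V"
  shows "(\<Sum>k\<le>card V. monom (of_nat (card {S. S \<subseteq> V \<and> P S \<and> card S = k})) k)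
    = (\<Sum>S | S \<subseteq> V \<and> P S. monom (1 :: 'b::comm_semiring_1) (card S))"
proof -
  have "(\<Sum>S | S \<subseteq> V \<and> P S. monom (1 :: 'b) (card S))
      = (\<Sum>k\<le>card V. \<Sum>S | S \<in> {S. S \<subseteq> V \<and> P S} \<and> card S = k. monom 1 (card S))"
    using assms by (intro sum.group[symmetric]) (auto intro: card_mono)
  also have "\<dots> = (\<Sum>k\<le>card V. monom (of_nat (card {S. S \<subseteq> V \<and> P S \<and> card S = k})) k)"
    by (intro sum.cong refl) (simp add: conj_assoc of_nat_monom mult_monom)
  finally show ?thesis ..
qed

text \<open>For \<open>m = 0\<close> the sets counted by the coefficient are the independent ones: an edge has at
  most one endpoint in \<open>S\<close> unless \<open>S\<close> contains both.\<close>

lemma indep_iff_card_inter_edge: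
  assumes "E \<subseteq> [V]\<^bsup>2\<^esup>"
  shows "indep S E \<longleftrightarrow> (\<forall>e\<in>E. card (S \<inter> e) \<in> {0, 1})"
proof
  assume indep: "indep S E"
  show "\<forall>e\<in>E. card (S \<inter> e) \<in> {0, 1}"
  proof
    fix e assume "e \<in> E"
    then obtain u v where e: "e = {u, v}" "u \<noteq> v"
      using assms by (auto simp: nsets_def card_2_iff)
    then have "\<not> (u \<in> S \<and> v \<in> S)"
      using indep \<open>e \<in> E\<close> by (auto simp: indep_def)
    then show "card (S \<inter> e) \<in> {0, 1}"
      using e by (cases "u \<in> S"; cases "v \<in> S") auto
  qed
next
  assume card: "\<forall>e\<in>E. card (S \<inter> e) \<in> {0, 1}"
  show "indep S E"
    unfolding indep_def
  proof (intro ballI impI notI)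
    fix u v assume "u \<in> S" "v \<in> S" "u \<noteq> v" "{u, v} \<in> E"
    then have "card (S \<inter> {u, v}) = 2"
      by (simp add: Int_absorb1)
    then show False
      using card \<open>{u, v} \<in> E\<close> by fastforce
  qed
qed

lemma vertex_cover_iff_card_inter_edge:
  assumes "E \<subseteq> [V]\<^bsup>2\<^esup>"
  shows "vertex_cover S E \<longleftrightarrow> (\<forall>e\<in>E. card (S \<inter> e) \<in> {1, 2})"
proof -
  have "e \<inter> S \<noteq> {} \<longleftrightarrow> card (S \<inter> e) \<in> {1, 2}" if "e \<in> E" for e
  proof -
    have e: "finite e" "card e = 2"
      using assms that by (auto simp: nsets_def)
    then have "card (S \<inter> e) \<le> 2"
      by (metis card_mono inf_le2)
    moreover have "card (S \<inter> e) = 0 \<longleftrightarrow> e \<inter> S = {}"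
      using e by (simp add: Int_commute)
    ultimately show ?thesis
      by auto
  qed
  then show ?thesis
    by (simp add: vertex_cover_def)
qed

theorem corollary5:
  fixes V :: "'a set" and E :: "'a set set"
  assumes "finite_simple_graph V E"
  shows "indep_poly V E = Poly_Mapping.lookup (graph_Psi V E) (edge_monom_exp E 1)
       \<and> cover_poly V E = Poly_Mapping.lookup (graph_Psi V E) (edge_monom_exp E 2)"
proof -
  have V: "finite V" and E: "E \<subseteq> [V]\<^bsup>2\<^esup>" "finite E"
    using assms finite_simple_graph_finite_edges by (auto simp: finite_simple_graph_def)
  have "indep_poly V E = (\<Sum>S | S \<subseteq> V \<and> indep S E. monom 1 (card S))"
    using sum_monom_card_subsets[OF V, where P = "\<lambda>S. indep S E" and 'b = int]
    by (simp add: indep_poly_def num_indep_sets_def)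
  also have "\<dots> = Poly_Mapping.lookup (graph_Psi V E) (edge_monom_exp E 1)"
    using lookup_graph_Psi[OF V E(2), of 0] by (simp add: indep_iff_card_inter_edge[OF E(1)])
  finally have indep: "indep_poly V E = Poly_Mapping.lookup (graph_Psi V E) (edge_monom_exp E 1)" .
  have "cover_poly V E = (\<Sum>S | S \<subseteq> V \<and> vertex_cover S E. monom 1 (card S))"
    using sum_monom_card_subsets[OF V, where P = "\<lambda>S. vertex_cover S E" and 'b = int]
    by (simp add: cover_poly_def num_vertex_covers_def)
  also have "\<dots> = Poly_Mapping.lookup (graph_Psi V E) (edge_monom_exp E 2)"
    using lookup_graph_Psi[OF V E(2), of 1]
    by (simp add: vertex_cover_iff_card_inter_edge[OF E(1)] numeral_2_eq_2)
  finally show ?thesis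
    using indep by blast
qed

end
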